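(* Let $(\mathrm{X}, \varphi)$ be an invertible measure-preserving system, let $F \subseteq \mathrm{L}^2(\mathrm{X})$ be a finite-dimensional linear subspace and let $\varepsilon > 0$. Then there exist $K_0 \in \mathbb{N}$ and $\delta > 0$ with the following property: whenever $K \geq K_0$ and $\hat T \colon F \to F$ is a linear operator such that $$\lVert \hat T^k f - T_\varphi^k f \rVert \leq \delta \lVert f \rVert \quad\text{for all } f \in F \text{ and all } k \in \{0, \dots, K - 1\},$$ then $$\dim(F) \geq K \bigl(h_{\mathrm{apr}}(T_\varphi, F) - \varepsilon\bigr).$$
   Context: A measure-preserving system $(\mathrm{X},\varphi)$ consists of a probability space $\mathrm{X}=(X,\Sigma,\mu)$ and a $\Sigma$-measurable map $\varphi\colon X\to X$ with $\mu(\varphi^{-1}(A))=\mu(A)$ for all $A\in\Sigma$. It is invertible if there is a measure-preserving map $\varphi^{-1}\colon X\to X$ with $\varphi^{-1}\circ\varphi=\varphi\circ\varphi^{-1}=\mathrm{id}_X$ $\mu$-almost surely. $\mathrm{L}^2(\mathrm{X})$ is the usual Hilbert space of (classes of) square-integrable functions $X\to\mathbb{K}$, $\mathbb{K}\in\{\mathbb{R},\mathbb{C}\}$, with its norm $\lVert\cdot\rVert$. The Koopman operator is $T_\varphi f=f\circ\varphi$ on $\mathrm{L}^2(\mathrm{X})$; it is unitary when the system is invertible. Approximation entropy. Let $H$ be a Hilbert space and $T\colon H\to H$ unitary. For a finite set $\omega\subseteq H$ and $\delta>0$ let $H_{\mathrm{apr}}(\omega,\delta)$ be the minimum of $\dim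 E$ over all finite-dimensional subspaces $E\subseteq H$ such that for every $x\in\omega$ there is $y\in E$ with $\lVert x-y\rVert<\delta$. Put $h_{\mathrm{apr}}(T,\omega,\delta):=\lim_{n\to\infty}\frac1n H_{\mathrm{apr}}\bigl(\bigcup_{k=0}^{n-1}T^k\omega,\delta\bigr)$ (the limit exists) and $h_{\mathrm{apr}}(T,\omega):=\sup_{\delta>0}h_{\mathrm{apr}}(T,\omega,\delta)$. For a closed linear subspace $F\subseteq H$ (not necessarily $T$-invariant), $h_{\mathrm{apr}}(T,F):=\sup\{h_{\mathrm{apr}}(T,\omega):\omega\subseteq F\text{ finite}\}$. *)

theory Defs
  imports "HOL-Probability.Probability" "Jordan_Normal_Form.VS_Connect"
begin

section \<open>Measure-preserving systems\<close>

definition measure_preserving :: "'a measure \<Rightarrow> ('a \<Rightarrow> 'a) \<Rightarrow> bool" where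
  "measure_preserving M \<phi> \<longleftrightarrow>
     \<phi> \<in> measurable M M \<and>
     (\<forall>A\<in>sets M. emeasure M (\<phi> -` A \<inter> space M) = emeasure M A)"

definition invertible_mps :: "'a measure \<Rightarrow> ('a \<Rightarrow> 'a) \<Rightarrow> bool" where
  "invertible_mps M \<phi> \<longleftrightarrow>
     prob_space M \<and> measure_preserving M \<phi> \<and>
     (\<exists>\<psi>. measure_preserving M \<psi> \<and> (AE x in M. \<psi> (\<phi> x) = x) \<and> (AE x in M. \<phi> (\<psi> x) = x))"

section \<open>The space of square-integrable functions and the Koopman operator\<close>

text \<open>
  The scalar field is a type of class \<open>{real_normed_field, euclidean_space}\<close>, i.e. a
  finite-dimensional commutative real division algebra with multiplicative norm. Up to isometric
  isomorphism these are exactly \<^typ>\<open>real\<close> and \<^typ>\<open>complex\<close>.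

  A vector is an almost-everywhere class, i.e. a set of functions. Functions are unconstrained
  outside \<open>space M\<close>, where the a.e. relation does not look either.
\<close>

record ('k, 'v) normed_module = "('k, 'v) module" +
  vnorm :: "'v \<Rightarrow> real"  (\<open>\<parallel>_\<parallel>\<index>\<close>)

definition square_integrable ::
  "'a measure \<Rightarrow> ('a \<Rightarrow> 'k :: {real_normed_field, euclidean_space}) set" where
  "square_integrable M = {f \<in> borel_measurable M. integrable M (\<lambda>x. (norm (f x))\<^sup>2)}"

definition ae_class ::
  "'a measure \<Rightarrow> ('a \<Rightarrow> 'k :: {real_normed_field, euclidean_space}) \<Rightarrow> ('a \<Rightarrow> 'k) set" where
  "ae_class M f = {g \<in> borel_measurable M. AE x in M. g x = f x}"

definition rep :: "('a \<Rightarrow> 'k) set \<Rightarrow> 'a \<Rightarrow> 'k" where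
  "rep u = (SOME f. f \<in> u)"

text \<open>
  The fields \<^const>\<open>monoid.mult\<close> and \<^const>\<open>monoid.one\<close> are inherited from the record of modules and
  play no role in a vector space.
\<close>

definition L2 :: "'a measure \<Rightarrow>
    ('k :: {real_normed_field, euclidean_space}, ('a \<Rightarrow> 'k) set) normed_module" where
  "L2 M = \<lparr>
     carrier = ae_class M ` square_integrable M,
     mult = (\<lambda>u v. ae_class M (\<lambda>x. 0)),
     one = ae_class M (\<lambda>x. 0),
     zero = ae_class M (\<lambda>x. 0),
     add = (\<lambda>u v. ae_class M (\<lambda>x. rep u x + rep v x)),
     smult = (\<lambda>c u. ae_class M (\<lambda>x. c * rep u x)),
     vnorm = (\<lambda>u. sqrt (\<integral>x. (norm (rep u x))\<^sup>2 \<partial>M)) \<rparr>"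

definition koopman :: "'a measure \<Rightarrow> ('a \<Rightarrow> 'a) \<Rightarrow>
    ('a \<Rightarrow> 'k :: {real_normed_field, euclidean_space}) set \<Rightarrow> ('a \<Rightarrow> 'k) set" where
  "koopman M \<phi> u = ae_class M (rep u \<circ> \<phi>)"

text \<open>The representatives are immaterial, and \<open>L2 M\<close> is indeed a vector space.\<close>

lemma ae_class_eqI:
  "(AE x in M. f x = g x) \<Longrightarrow> ae_class M f = ae_class M g"
  unfolding ae_class_def by (auto elim!: eventually_elim2)

lemma ae_class_rep:
  assumes "f \<in> borel_measurable M"
  shows "rep (ae_class M f) \<in> borel_measurable M" "AE x in M. rep (ae_class M f) x = f x"
proof -
  have "f \<in> ae_class M f" using assms by (simp add: ae_class_def)
  then have "rep (ae_class M f) \<in> ae_class M f" unfolding rep_def by (rule someI[where P = "\<lambda>g. g \<in> ae_class M f"])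
  then show "rep (ae_class M f) \<in> borel_measurable M" "AE x in M. rep (ae_class M f) x = f x"
    by (auto simp: ae_class_def)
qed

lemma square_integrable_measurable:
  "f \<in> square_integrable M \<Longrightarrow> f \<in> borel_measurable M"
  by (simp add: square_integrable_def)

lemma square_integrable_zero: "(\<lambda>x. 0) \<in> square_integrable M"
  by (simp add: square_integrable_def)

lemma square_integrable_scale:
  "f \<in> square_integrable M \<Longrightarrow> (\<lambda>x. c * f x) \<in> square_integrable M"
  by (auto simp: square_integrable_def norm_mult power_mult_distrib)

lemma square_integrable_add:
  assumes f: "f \<in> square_integrable M" and g: "g \<in> square_integrable M"
  shows "(\<lambda>x. f x + g x) \<in> square_integrable M"
proof -
  have [measurable]: "f \<in> borel_measurable M" "g \<in> borel_measurable M"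
    using f g by (auto simp: square_integrable_def)
  have "integrable M (\<lambda>x. 2 * (norm (f x))\<^sup>2 + 2 * (norm (g x))\<^sup>2)"
    using f g by (auto simp: square_integrable_def)
  moreover have "(norm (f x + g x))\<^sup>2 \<le> 2 * (norm (f x))\<^sup>2 + 2 * (norm (g x))\<^sup>2" for x
  proof -
    have "(norm (f x + g x))\<^sup>2 \<le> (norm (f x) + norm (g x))\<^sup>2"
      by (intro power_mono norm_triangle_ineq) auto
    also have "\<dots> \<le> 2 * (norm (f x))\<^sup>2 + 2 * (norm (g x))\<^sup>2"
      using zero_le_power2[of "norm (f x) - norm (g x)"]
      by (simp add: power2_sum power2_diff)
    finally show ?thesis .
  qed
  ultimately have "integrable M (\<lambda>x. (norm (f x + g x))\<^sup>2)"
    by (auto intro!: Bochner_Integration.integrable_bound[where g = "\<lambda>x. (norm (f x + g x))\<^sup>2"]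
        order.trans[OF _ abs_ge_self])
  then show ?thesis by (simp add: square_integrable_def)
qed

lemma L2_carrierE:
  assumes "u \<in> carrier (L2 M)"
  obtains f where "f \<in> square_integrable M" "u = ae_class M f"
  using assms by (auto simp: L2_def)

lemma L2_zero: "\<zero>\<^bsub>L2 M\<^esub> = ae_class M (\<lambda>x. 0)"
  by (simp add: L2_def)

lemma L2_add:
  assumes "f \<in> borel_measurable M" "g \<in> borel_measurable M"
  shows "ae_class M f \<oplus>\<^bsub>L2 M\<^esub> ae_class M g = ae_class M (\<lambda>x. f x + g x)"
  using ae_class_rep(2)[OF assms(1)] ae_class_rep(2)[OF assms(2)]
  by (auto simp: L2_def intro!: ae_class_eqI elim: eventually_elim2)

lemma L2_smult:
  assumes "f \<in> borel_measurable M"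
  shows "c \<odot>\<^bsub>L2 M\<^esub> ae_class M f = ae_class M (\<lambda>x. c * f x)"
  using ae_class_rep(2)[OF assms]
  by (auto simp: L2_def intro!: ae_class_eqI elim: eventually_mono)

lemma L2_vnorm:
  assumes [measurable]: "f \<in> borel_measurable M"
  shows "\<parallel>ae_class M f\<parallel>\<^bsub>L2 M\<^esub> = sqrt (\<integral>x. (norm (f x))\<^sup>2 \<partial>M)"
proof -
  have [measurable]: "rep (ae_class M f) \<in> borel_measurable M"
    by (rule ae_class_rep(1)) fact
  have "(\<integral>x. (norm (rep (ae_class M f) x))\<^sup>2 \<partial>M) = (\<integral>x. (norm (f x))\<^sup>2 \<partial>M)"
    using ae_class_rep(2)[OF assms]
    by (intro integral_cong_AE) (auto elim: eventually_mono)
  then show ?thesis by (simp add: L2_def)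
qed

lemma measure_preserving_distr:
  assumes "measure_preserving M \<phi>"
  shows "distr M M \<phi> = M"
  using assms by (intro measure_eqI) (auto simp: measure_preserving_def emeasure_distr)

lemma koopman_ae_class:
  assumes \<phi>: "measure_preserving M \<phi>" and f: "f \<in> borel_measurable M"
  shows "koopman M \<phi> (ae_class M f) = ae_class M (f \<circ> \<phi>)"
proof -
  have "AE x in distr M M \<phi>. rep (ae_class M f) x = f x"
    using ae_class_rep(2)[OF f] unfolding measure_preserving_distr[OF \<phi>] .
  then have "AE x in M. rep (ae_class M f) (\<phi> x) = f (\<phi> x)"
    by (rule AE_distrD[rotated]) (use \<phi> in \<open>simp add: measure_preserving_def\<close>)
  then show ?thesis unfolding koopman_def by (intro ae_class_eqI) simp
qed

lemma vectorspace_L2: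
  "vectorspace (class_ring :: 'k :: {real_normed_field, euclidean_space} ring) (L2 M)"
proof (rule vs_criteria)
  show "field (class_ring :: 'k ring)" by (rule class_field)
next
  show "\<zero>\<^bsub>L2 M\<^esub> \<in> carrier (L2 M)"
    using square_integrable_zero[of M] by (auto simp: L2_def)
next
  show "\<forall>v w. v \<in> carrier (L2 M) \<and> w \<in> carrier (L2 M) \<longrightarrow> v \<oplus>\<^bsub>L2 M\<^esub> w \<in> carrier (L2 M)"
    by (auto elim!: L2_carrierE simp: L2_add square_integrable_measurable)
       (auto simp: L2_def square_integrable_add)
next
  show "\<forall>v\<in>carrier (L2 M). \<exists>w\<in>carrier (L2 M). v \<oplus>\<^bsub>L2 M\<^esub> w = \<zero>\<^bsub>L2 M\<^esub>"
  proof
    fix v assume "v \<in> carrier (L2 M)"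
    then obtain f where f: "f \<in> square_integrable M" "v = ae_class M f" by (rule L2_carrierE)
    have g: "(\<lambda>x. -1 * f x) \<in> square_integrable M"
      using f(1) by (rule square_integrable_scale)
    have "v \<oplus>\<^bsub>L2 M\<^esub> ae_class M (\<lambda>x. -1 * f x) = \<zero>\<^bsub>L2 M\<^esub>"
      using f g by (simp add: L2_add L2_zero square_integrable_measurable)
    moreover have "ae_class M (\<lambda>x. -1 * f x) \<in> carrier (L2 M)"
      using g by (auto simp: L2_def)
    ultimately show "\<exists>w\<in>carrier (L2 M). v \<oplus>\<^bsub>L2 M\<^esub> w = \<zero>\<^bsub>L2 M\<^esub>" by blast
  qed
next
  show "\<forall>c v. c \<in> carrier (class_ring :: 'k ring) \<and> v \<in> carrier (L2 M) \<longrightarrow> c \<odot>\<^bsub>L2 M\<^esub> v \<in> carrier (L2 M)"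
    by (auto elim!: L2_carrierE simp: L2_smult square_integrable_measurable)
       (auto simp: L2_def square_integrable_scale)
qed (auto elim!: L2_carrierE simp: L2_add L2_smult L2_zero square_integrable_measurable
      borel_measurable_add borel_measurable_times algebra_simps class_ring_simps)

section \<open>Approximation entropy\<close>

text \<open>
  The library writes a subspace \<open>E\<close> of \<open>V\<close>, regarded as a space in its own right,
  as \<open>V\<lparr>carrier := E\<rparr>\<close>.
\<close>

definition fin_dim_subspace ::
  "('k :: {real_normed_field, euclidean_space}, 'v, 'm) module_scheme \<Rightarrow> 'v set \<Rightarrow> bool" where
  "fin_dim_subspace V E \<longleftrightarrow>
     VectorSpace.subspace class_ring E V \<and>
     vectorspace.fin_dim class_ring (V\<lparr>carrier := E\<rparr>)"

definition dim_of ::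
  "('k :: {real_normed_field, euclidean_space}, 'v, 'm) module_scheme \<Rightarrow> 'v set \<Rightarrow> nat" where
  "dim_of V E = vectorspace.dim class_ring (V\<lparr>carrier := E\<rparr>)"

definition H_apr :: "('k :: {real_normed_field, euclidean_space}, 'v, 'm) normed_module_scheme \<Rightarrow>
    'v set \<Rightarrow> real \<Rightarrow> nat" where
  "H_apr H \<omega> \<delta> = (LEAST n. \<exists>E. fin_dim_subspace H E \<and> dim_of H E = n \<and>
     (\<forall>x\<in>\<omega>. \<exists>y\<in>E. \<parallel>x \<ominus>\<^bsub>H\<^esub> y\<parallel>\<^bsub>H\<^esub> < \<delta>))"

definition h_apr_delta ::
  "('k :: {real_normed_field, euclidean_space}, 'v, 'm) normed_module_scheme \<Rightarrow>
    ('v \<Rightarrow> 'v) \<Rightarrow> 'v set \<Rightarrow> real \<Rightarrow> real" where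
  "h_apr_delta H T \<omega> \<delta> = lim (\<lambda>n. real (H_apr H (\<Union>k<n. (T ^^ k) ` \<omega>) \<delta>) / real n)"

definition h_apr_finite ::
  "('k :: {real_normed_field, euclidean_space}, 'v, 'm) normed_module_scheme \<Rightarrow>
    ('v \<Rightarrow> 'v) \<Rightarrow> 'v set \<Rightarrow> ereal" where
  "h_apr_finite H T \<omega> = (SUP \<delta>\<in>{0<..}. ereal (h_apr_delta H T \<omega> \<delta>))"

definition h_apr ::
  "('k :: {real_normed_field, euclidean_space}, 'v, 'm) normed_module_scheme \<Rightarrow>
    ('v \<Rightarrow> 'v) \<Rightarrow> 'v set \<Rightarrow> ereal" where
  "h_apr H T F = (SUP \<omega>\<in>{\<omega>. finite \<omega> \<and> \<omega> \<subseteq> F}. h_apr_finite H T \<omega>)"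

end

theory Submission
  imports Defs
begin

text \<open>
  For an isometry \<open>T\<close> and a finite set \<open>\<omega>\<close>, the numbers \<open>H_apr\<close> of the orbit segments
  \<open>\<omega> \<union> \<dots> \<union> T\<^sup>n\<^sup>-\<^sup>1 \<omega>\<close> are subadditive in \<open>n\<close>: if \<open>E\<close> approximates the first \<open>m\<close> steps and \<open>E'\<close> the
  first \<open>n\<close> steps, then \<open>E + T\<^sup>m E'\<close> approximates the first \<open>m + n\<close>. By Fekete's lemma the limit is
  therefore at most \<open>1/K\<close> times the value for \<open>K\<close> steps. If \<open>\<omega> \<subseteq> F\<close> and \<open>S\<^sup>k f\<close> stays close to
  \<open>T\<^sup>k f\<close> for \<open>k < K\<close>, then \<open>F\<close> itself approximates the first \<open>K\<close> steps, so that value is at most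
  the dimension of \<open>F\<close>. It remains to choose \<open>\<omega>\<close> and \<open>\<delta>\<close> that nearly attain the entropy, which is finite
  by the same bound with \<open>K = 1\<close>.
\<close>

section \<open>Fekete's lemma for nonnegative subadditive sequences\<close>

lemma subadditive_tendsto_Inf:
  fixes a :: "nat \<Rightarrow> real"
  assumes nonneg: "\<And>n. 0 \<le> a n" and subadd: "\<And>m n. a (m + n) \<le> a m + a n"
  shows "(\<lambda>n. a n / n) \<longlonglongrightarrow> (INF n\<in>{1..}. a n / n)"
proof (rule order_tendstoI)
  have bdd: "bdd_below ((\<lambda>n. a n / n) ` {1..})"
    using nonneg by (intro bdd_belowI[where m = 0]) auto
  show "\<forall>\<^sub>F n in sequentially. y < a n / n" if "y < (INF n\<in>{1..}. a n / n)" for y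
    using eventually_ge_at_top[of 1]
  proof eventually_elim
    case (elim n)
    then have "(INF n\<in>{1..}. a n / n) \<le> a n / n"
      by (intro cINF_lower[OF bdd]) auto
    with that show ?case by linarith
  qed
  show "\<forall>\<^sub>F n in sequentially. a n / n < y" if "(INF n\<in>{1..}. a n / n) < y" for y
  proof -
    have "\<exists>K\<in>{1..}. a K / K < y"
      using that by (subst (asm) cINF_less_iff[OF _ bdd]) auto
    then obtain K where K: "K \<ge> 1" "a K / K < y" by auto
    \<comment> \<open>Division with remainder by the fixed \<open>K\<close> splits
      \<open>a n\<close> into \<open>n div K\<close> copies of \<open>a K\<close> and one term
      \<open>a (n mod K)\<close>. The constant \<open>C\<close> bounds all possible remainder terms
      at once, so their share of \<open>a n / n\<close> is at most \<open>C / n\<close> and vanishes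
      in the limit.\<close>
    define C where "C = Max (a ` {..<K})"
    have mult: "a (q * K + r) \<le> q * a K + a r" for q r
    proof (induction q)
      case (Suc q)
      have "a (Suc q * K + r) \<le> a K + a (q * K + r)"
        using subadd[of K "q * K + r"] by (simp add: add.assoc)
      with Suc show ?case by (simp add: algebra_simps)
    qed simp
    have "(\<lambda>n. a K / K + C / real n) \<longlonglongrightarrow> a K / K + 0"
      by (intro tendsto_intros lim_const_over_n)
    then have "\<forall>\<^sub>F n in sequentially. a K / K + C / real n < y"
      using K(2) by (intro order_tendstoD) auto
    then show ?thesis
      using eventually_ge_at_top[of 1]
    proof eventually_elim
      case (elim n)
      have "a (n mod K) \<le> C"
        unfolding C_def using K(1) by (intro Max_ge) auto
      then have "a n \<le> real (n div K) * a K + C"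
        using mult[of "n div K" "n mod K"] by simp
      \<comment> \<open>Replacing \<open>n div K\<close> by the larger quotient \<open>n / K\<close>
        keeps the inequality because \<open>a K\<close> is nonnegative.\<close>
      also have "\<dots> \<le> (real n / real K) * a K + C"
        by (intro add_right_mono mult_right_mono nonneg of_nat_div_le_of_nat)
      finally have "a n / n \<le> ((real n / real K) * a K + C) / n"
        by (rule divide_right_mono) simp
      also have "\<dots> = a K / K + C / n"
        using elim by (simp add: field_simps)
      finally show ?case using elim by linarith
    qed
  qed
qed

text \<open>The term \<open>lim\<close> is a definite description and says nothing without
  convergence. Fekete's lemma supplies convergence and identifies the value as an infimum, of which
  \<open>a K / K\<close> is one member.\<close>

lemma lim_subadditive_le:
  fixes a :: "nat \<Rightarrow> real"
  assumes nonneg: "\<And>n. 0 \<le> a n" and subadd: "\<And>m n. a (m + n) \<le> a m + a n" and "K > 0"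
  shows "lim (\<lambda>n. a n / n) \<le> a K / K"
proof -
  have "lim (\<lambda>n. a n / n) = (INF n\<in>{1..}. a n / n)"
    by (intro limI subadditive_tendsto_Inf nonneg subadd)
  also have "\<dots> \<le> a K / K"
    using nonneg \<open>K > 0\<close> by (intro cINF_lower bdd_belowI[where m = 0]) auto
  finally show ?thesis .
qed

section \<open>Finite-dimensional subspaces as spans of finite sets\<close>

lemma fin_dim_subspace_imp_span:
  fixes V :: "('k :: {real_normed_field, euclidean_space}, 'v, 'm) module_scheme"
  assumes "fin_dim_subspace V E"
  obtains B where "finite B" "B \<subseteq> E" "E \<subseteq> carrier V" "E = module.span class_ring V B"
    "card B = dim_of V E"
proof -
  have sub: "VectorSpace.subspace class_ring E V"
    and fd: "vectorspace.fin_dim class_ring (V\<lparr>carrier := E\<rparr>)"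
    using assms by (auto simp: fin_dim_subspace_def)
  interpret V: vectorspace "class_ring :: 'k ring" V
    using sub by (simp add: VectorSpace.subspace_def)
  interpret E: vectorspace "class_ring :: 'k ring" "V\<lparr>carrier := E\<rparr>"
    by (rule V.subspace_is_vs[OF sub])
  obtain B where B: "finite B" "E.basis B"
    using E.finite_basis_exists[OF fd] by blast
  have "card B = dim_of V E"
    unfolding dim_of_def by (rule E.dim_basis[OF B, symmetric])
  moreover have BE: "B \<subseteq> E" using B(2) by (simp add: E.basis_def)
  \<comment> \<open>The basis lives in the space with carrier restricted to \<open>E\<close>. Spans
    of subsets of \<open>E\<close> are the same there and in \<open>V\<close>, so it spans
    \<open>E\<close> inside \<open>V\<close> as well.\<close>
  moreover have "E = module.span class_ring V B"
    using B(2) V.module.span_li_not_depend(1)[OF BE V.is_module[OF sub]] by (simp add: E.basis_def)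
  moreover have "E \<subseteq> carrier V"
    using V.is_module[OF sub] by (simp add: submodule_def)
  ultimately show ?thesis using B(1) that by blast
qed

text \<open>Together with the previous lemma this lets finite spanning sets replace subspaces: a sum
  of subspaces becomes a union of sets. Only an upper bound on the dimension is available for a
  spanning set, which suffices because \<open>H_apr\<close> is a minimum.\<close>

lemma span_fin_dim_subspace:
  fixes V :: "('k :: {real_normed_field, euclidean_space}, 'v, 'm) module_scheme"
  assumes "vectorspace (class_ring :: 'k ring) V" "finite B" "B \<subseteq> carrier V"
  shows "fin_dim_subspace V (module.span class_ring V B)"
    and "dim_of V (module.span class_ring V B) \<le> card B"
proof -
  interpret V: vectorspace "class_ring :: 'k ring" V by fact
  have sub: "VectorSpace.subspace class_ring (V.span B) V"
    by (rule V.span_is_subspace[OF assms(3)])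
  interpret E: vectorspace "class_ring :: 'k ring" "V\<lparr>carrier := V.span B\<rparr>"
    by (rule V.subspace_is_vs[OF sub])
  have B: "B \<subseteq> V.span B" by (rule V.in_own_span[OF assms(3)])
  have gen: "E.span B = V.span B"
    using V.module.span_li_not_depend(1)[OF B V.is_module[OF sub]] by simp
  show "fin_dim_subspace V (V.span B)"
    unfolding fin_dim_subspace_def E.fin_dim_def using sub gen B assms(2) by auto
  show "dim_of V (V.span B) \<le> card B"
    unfolding dim_of_def using gen B assms(2) by (intro E.gen_ge_dim) auto
qed

lemma (in mod_hom) image_span_subset:
  assumes "B \<subseteq> carrier M"
  shows "f ` M.span B \<subseteq> N.span (f ` B)"
proof -
  have fB: "f ` B \<subseteq> carrier N" using assms by auto
  have sub: "submodule R (N.span (f ` B)) N" by (rule N.span_is_submodule[OF fB])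
  have "submodule R {v \<in> carrier M. f v \<in> N.span (f ` B)} M"
    using sub by (intro submodule.intro M.module_axioms) (auto simp: submodule_def)
  moreover have "B \<subseteq> {v \<in> carrier M. f v \<in> N.span (f ` B)}"
    using assms N.in_own_span[OF fB] by auto
  ultimately have "M.span B \<subseteq> {v \<in> carrier M. f v \<in> N.span (f ` B)}"
    by (intro M.span_is_subset)
  then show ?thesis by auto
qed

section \<open>Approximation entropy of a linear isometry\<close>

locale linear_isometry = vectorspace class_ring H
  for H :: "('k :: {real_normed_field, euclidean_space}, 'v, 'm) normed_module_scheme" (structure) +
  fixes T :: "'v \<Rightarrow> 'v"
  assumes vnorm_smult: "v \<in> carrier H \<Longrightarrow> \<parallel>c \<odot> v\<parallel> = norm c * \<parallel>v\<parallel>"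
    and T_hom: "T \<in> module_hom class_ring H H"
    and vnorm_T: "v \<in> carrier H \<Longrightarrow> \<parallel>T v\<parallel> = \<parallel>v\<parallel>"
begin

lemma vnorm_zero: "\<parallel>\<zero>\<parallel> = 0"
  using vnorm_smult[of \<zero> 0] by (simp add: class_ring_simps)

text \<open>Homogeneity for the scalar -1. It is used because \<open>H_apr\<close> measures orbit
  point minus approximant, while the closeness hypothesis on \<open>S\<close> has the difference in
  the opposite order.\<close>

lemma vnorm_minus_commute:
  assumes "v \<in> carrier H" "w \<in> carrier H"
  shows "\<parallel>v \<ominus> w\<parallel> = \<parallel>w \<ominus> v\<parallel>"
proof -
  have "v \<ominus> w = \<ominus> (w \<ominus> v)"
    using assms by (simp add: a_minus_def M.minus_add M.a_comm)
  also have "\<dots> = (- 1) \<odot> (w \<ominus> v)"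
    using assms smult_minus_1[of "w \<ominus> v"] by (simp add: class_ring_simps)
  finally show ?thesis
    using assms by (simp add: vnorm_smult)
qed

lemma T_pow_hom: "T ^^ n \<in> module_hom class_ring H H"
proof (induction n)
  case (Suc n)
  with T_hom show ?case
    by (auto simp: module_hom_def Pi_iff)
qed (auto simp: module_hom_def)

lemma T_pow_closed: "v \<in> carrier H \<Longrightarrow> (T ^^ n) v \<in> carrier H"
  using module_hom_closed[OF T_pow_hom] by auto

lemma vnorm_T_pow: "v \<in> carrier H \<Longrightarrow> \<parallel>(T ^^ n) v\<parallel> = \<parallel>v\<parallel>"
  by (induction n) (auto simp: vnorm_T T_pow_closed)

lemma mod_hom_T_pow: "mod_hom class_ring H H (T ^^ n)"
  by unfold_locales (rule T_pow_hom)

lemma vnorm_T_pow_minus: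
  assumes "v \<in> carrier H" "w \<in> carrier H"
  shows "\<parallel>(T ^^ n) v \<ominus> (T ^^ n) w\<parallel> = \<parallel>v \<ominus> w\<parallel>"
proof -
  interpret Tn: mod_hom class_ring H H "T ^^ n" by (rule mod_hom_T_pow)
  show ?thesis using assms vnorm_T_pow[of "v \<ominus> w" n] Tn.f_minus by simp
qed

lemma H_apr_le_dim:
  assumes "fin_dim_subspace H E" "\<And>x. x \<in> \<omega> \<Longrightarrow> \<exists>y\<in>E. \<parallel>x \<ominus> y\<parallel> < \<delta>"
  shows "H_apr H \<omega> \<delta> \<le> dim_of H E"
  unfolding H_apr_def by (intro Least_le exI[of _ E]) (use assms in auto)

lemma H_apr_le_card:
  assumes "finite B" "B \<subseteq> carrier H" "\<And>x. x \<in> \<omega> \<Longrightarrow> \<exists>y\<in>span B. \<parallel>x \<ominus> y\<parallel> < \<delta>"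
  shows "H_apr H \<omega> \<delta> \<le> card B"
  by (rule order_trans[OF H_apr_le_dim[OF span_fin_dim_subspace(1)]
        span_fin_dim_subspace(2)]) (use assms vectorspace_axioms in auto)

text \<open>The \<open>LEAST\<close> in \<open>H_apr\<close> is attained once some admissible
  subspace exists. The span of \<open>\<omega>\<close> is one: it contains each point of
  \<open>\<omega>\<close>, at distance 0 from itself.\<close>

lemma H_apr_attained:
  assumes "finite \<omega>" "\<omega> \<subseteq> carrier H" "\<delta> > 0"
  obtains B where "finite B" "B \<subseteq> carrier H" "card B = H_apr H \<omega> \<delta>"
    "\<And>x. x \<in> \<omega> \<Longrightarrow> \<exists>y\<in>span B. \<parallel>x \<ominus> y\<parallel> < \<delta>"
proof -
  let ?P = "\<lambda>n. \<exists>E. fin_dim_subspace H E \<and> dim_of H E = n \<and>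
     (\<forall>x\<in>\<omega>. \<exists>y\<in>E. \<parallel>x \<ominus> y\<parallel> < \<delta>)"
  have "\<exists>y\<in>span \<omega>. \<parallel>x \<ominus> y\<parallel> < \<delta>" if "x \<in> \<omega>" for x
    using that assms in_own_span[OF assms(2)]
    by (intro bexI[of _ x]) (auto simp: a_minus_def M.r_neg vnorm_zero subset_iff)
  then have "?P (dim_of H (span \<omega>))"
    using span_fin_dim_subspace(1)[OF vectorspace_axioms assms(1,2)] by blast
  then have "?P (H_apr H \<omega> \<delta>)"
    unfolding H_apr_def by (rule LeastI)
  then obtain E where E: "fin_dim_subspace H E" "dim_of H E = H_apr H \<omega> \<delta>"
    "\<forall>x\<in>\<omega>. \<exists>y\<in>E. \<parallel>x \<ominus> y\<parallel> < \<delta>" by blast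
  from E(1) obtain B where "finite B" "B \<subseteq> E" "E \<subseteq> carrier H" "E = span B"
    "card B = dim_of H E" by (rule fin_dim_subspace_imp_span)
  with E show ?thesis by (intro that[of B]) auto
qed

lemma H_apr_orbit_subadditive:
  assumes "finite \<omega>" "\<omega> \<subseteq> carrier H" "\<delta> > 0"
  shows "H_apr H (\<Union>k<m+n. (T ^^ k) ` \<omega>) \<delta> \<le>
    H_apr H (\<Union>k<m. (T ^^ k) ` \<omega>) \<delta> + H_apr H (\<Union>k<n. (T ^^ k) ` \<omega>) \<delta>"
proof -
  have fin: "finite (\<Union>k<n. (T ^^ k) ` \<omega>)" and carr: "(\<Union>k<n. (T ^^ k) ` \<omega>) \<subseteq> carrier H" for n
    using assms T_pow_closed by auto
  obtain B where B: "finite B" "B \<subseteq> carrier H" "card B = H_apr H (\<Union>k<m. (T ^^ k) ` \<omega>) \<delta>"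
    "\<And>x. x \<in> (\<Union>k<m. (T ^^ k) ` \<omega>) \<Longrightarrow> \<exists>y\<in>span B. \<parallel>x \<ominus> y\<parallel> < \<delta>"
    using H_apr_attained[OF fin carr assms(3)] by metis
  obtain C where C: "finite C" "C \<subseteq> carrier H" "card C = H_apr H (\<Union>k<n. (T ^^ k) ` \<omega>) \<delta>"
    "\<And>x. x \<in> (\<Union>k<n. (T ^^ k) ` \<omega>) \<Longrightarrow> \<exists>y\<in>span C. \<parallel>x \<ominus> y\<parallel> < \<delta>"
    using H_apr_attained[OF fin carr assms(3)] by metis
  interpret Tm: mod_hom class_ring H H "T ^^ m" by (rule mod_hom_T_pow)
  \<comment> \<open>A spanning set for the sum of the first subspace and the image of the second
    under \<open>T ^^ m\<close>.\<close>
  let ?D = "B \<union> (T ^^ m) ` C"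
  have D: "finite ?D" "?D \<subseteq> carrier H" using B C T_pow_closed by auto
  have "\<exists>y\<in>span ?D. \<parallel>x \<ominus> y\<parallel> < \<delta>" if x: "x \<in> (\<Union>k<m+n. (T ^^ k) ` \<omega>)" for x
  proof -
    obtain k v where k: "k < m + n" "v \<in> \<omega>" "x = (T ^^ k) v" using x by auto
    show ?thesis
    proof (cases "k < m")
      case True
      then show ?thesis using B(4)[of x] k span_is_monotone[of B ?D] by blast
    next
      case False
      \<comment> \<open>A late orbit point is \<open>T ^^ m\<close> applied to a point
        \<open>w\<close> among the first \<open>n\<close> steps. The isometry moves an approximant
        of \<open>w\<close> to an approximant of \<open>x\<close> with the same error.\<close>
      define w where "w = (T ^^ (k - m)) v"
      have w: "w \<in> (\<Union>k<n. (T ^^ k) ` \<omega>)" using False k by (auto simp: w_def)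
      have xw: "x = (T ^^ m) w"
        using False k funpow_add[of m "k - m" T] by (simp add: w_def)
      obtain y where y: "y \<in> span C" "\<parallel>w \<ominus> y\<parallel> < \<delta>" using C(4)[OF w] by blast
      have "(T ^^ m) y \<in> span ((T ^^ m) ` C)"
        using Tm.image_span_subset[OF C(2)] y(1) by auto
      then have "(T ^^ m) y \<in> span ?D" using span_is_monotone[of "(T ^^ m) ` C" ?D] by blast
      moreover have "\<parallel>x \<ominus> (T ^^ m) y\<parallel> < \<delta>"
        unfolding xw using y w carr span_closed[OF C(2) y(1)]
        by (subst vnorm_T_pow_minus) (auto simp: subset_iff)
      ultimately show ?thesis by blast
    qed
  qed
  then have "H_apr H (\<Union>k<m+n. (T ^^ k) ` \<omega>) \<delta> \<le> card ?D"
    by (intro H_apr_le_card D)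
  also have "\<dots> \<le> card B + card C"
    using card_Un_le[of B "(T ^^ m) ` C"] card_image_le[OF C(1), of "T ^^ m"] by linarith
  finally show ?thesis using B(3) C(3) by simp
qed

lemma h_apr_delta_le:
  assumes "finite \<omega>" "\<omega> \<subseteq> carrier H" "\<delta> > 0" "K > 0" "fin_dim_subspace H E"
    and "\<And>x k. x \<in> \<omega> \<Longrightarrow> k < K \<Longrightarrow> \<exists>y\<in>E. \<parallel>(T ^^ k) x \<ominus> y\<parallel> < \<delta>"
  shows "real K * h_apr_delta H T \<omega> \<delta> \<le> real (dim_of H E)"
proof -
  let ?a = "\<lambda>n. real (H_apr H (\<Union>k<n. (T ^^ k) ` \<omega>) \<delta>)"
  have "h_apr_delta H T \<omega> \<delta> \<le> ?a K / K"
    unfolding h_apr_delta_def using H_apr_orbit_subadditive[OF assms(1-3)] assms(4)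
    by (intro lim_subadditive_le) (auto simp flip: of_nat_add)
  also have "\<dots> \<le> real (dim_of H E) / K"
    using assms by (intro divide_right_mono of_nat_mono H_apr_le_dim) auto
  finally show ?thesis using assms(4) by (simp add: field_simps)
qed

text \<open>The tolerance is chosen before \<open>K\<close> and \<open>S\<close>: it depends only on
  a finite set and a precision that nearly attain the entropy.\<close>

theorem dim_ge_of_approximate_operator:
  assumes F: "fin_dim_subspace H F" and "\<epsilon> > 0"
  shows "\<exists>\<delta>>0. \<forall>K. \<forall>S \<in> F \<rightarrow> F.
    (\<forall>f\<in>F. \<forall>k<K. \<parallel>(S ^^ k) f \<ominus> (T ^^ k) f\<parallel> \<le> \<delta> * \<parallel>f\<parallel>) \<longrightarrow>
    ereal (real K) * (h_apr H T F - ereal \<epsilon>) \<le> ereal (real (dim_of H F))"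
proof -
  have "F \<subseteq> carrier H"
    using F by (rule fin_dim_subspace_imp_span)
  \<comment> \<open>Stated for an arbitrary \<open>S\<close> and \<open>K\<close> because it is
    applied twice: with \<open>id\<close> and \<open>K = 1\<close> to bound the entropy, and then
    with the given operator.\<close>
  have approx: "real K * h_apr_delta H T \<omega> \<delta> \<le> real (dim_of H F)"
    if \<omega>: "finite \<omega>" "\<omega> \<subseteq> F" and "\<delta> > 0" and S: "S \<in> F \<rightarrow> F"
      and le: "\<And>f k. f \<in> \<omega> \<Longrightarrow> k < K \<Longrightarrow> \<parallel>(S ^^ k) f \<ominus> (T ^^ k) f\<parallel> < \<delta>" for \<omega> \<delta> K S
  proof (cases "K = 0")
    case False
    have SF: "(S ^^ k) f \<in> F" if "f \<in> F" for k f
      using that S by (induction k) auto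
    have "\<exists>y\<in>F. \<parallel>(T ^^ k) x \<ominus> y\<parallel> < \<delta>" if "x \<in> \<omega>" "k < K" for x k
      using le[OF that] SF[of x k] that \<omega> \<open>F \<subseteq> carrier H\<close> T_pow_closed[of x k]
      by (intro bexI[of _ "(S ^^ k) x"]) (auto simp: vnorm_minus_commute subset_iff)
    then show ?thesis
      using \<omega> \<open>\<delta> > 0\<close> \<open>F \<subseteq> carrier H\<close> F False by (intro h_apr_delta_le) auto
  qed simp
  \<comment> \<open>For \<open>K = 1\<close> only the zeroth power occurs, where \<open>id\<close>
    and \<open>T\<close> agree exactly.\<close>
  have "h_apr_delta H T \<omega> \<delta> \<le> real (dim_of H F)" if "finite \<omega>" "\<omega> \<subseteq> F" "\<delta> > 0" for \<omega> \<delta>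
    using approx[of \<omega> \<delta> id 1] that \<open>F \<subseteq> carrier H\<close>
    by (auto simp: a_minus_def M.r_neg vnorm_zero subset_iff)
  then have ub: "h_apr H T F \<le> ereal (real (dim_of H F))"
    unfolding h_apr_def h_apr_finite_def by (auto intro!: SUP_least)
  \<comment> \<open>Any real member of the supremum excludes minus infinity. With the upper bound,
    the entropy is a real number \<open>h\<close>.\<close>
  have "ereal (h_apr_delta H T {} 1) \<le> h_apr H T F"
    unfolding h_apr_def h_apr_finite_def
    by (intro SUP_upper2[of "{}"] SUP_upper) auto
  with ub obtain h where h: "h_apr H T F = ereal h"
    by (cases "h_apr H T F") auto
  then have "ereal (h - \<epsilon>) < h_apr H T F" using \<open>\<epsilon> > 0\<close> by simp
  then obtain \<omega> \<delta> where \<omega>: "finite \<omega>" "\<omega> \<subseteq> F" and "\<delta> > 0"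
    and lt: "h - \<epsilon> < h_apr_delta H T \<omega> \<delta>"
    unfolding h_apr_def h_apr_finite_def by (auto simp: less_SUP_iff)
  \<comment> \<open>\<open>R\<close> bounds the norms on \<open>\<omega>\<close>, and inserting 0
    covers the empty set and gives \<open>0 \<le> R\<close>. The relative tolerance
    \<open>\<delta> / (R + 1)\<close> then yields absolute errors strictly below
    \<open>\<delta>\<close> on \<open>\<omega>\<close>.\<close>
  define R where "R = Max (insert 0 (vnorm H ` \<omega>))"
  have R: "0 \<le> R" "\<And>f. f \<in> \<omega> \<Longrightarrow> \<parallel>f\<parallel> \<le> R"
    unfolding R_def using \<omega>(1) by auto
  have small: "\<delta> / (R + 1) * \<parallel>f\<parallel> < \<delta>" if "f \<in> \<omega>" for f
    using R(1) R(2)[OF that] \<open>\<delta> > 0\<close> mult_strict_left_mono[of "\<parallel>f\<parallel>" "R + 1" \<delta>]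
    by (simp add: pos_divide_less_eq)
  have "ereal (real K) * (h_apr H T F - ereal \<epsilon>) \<le> ereal (real (dim_of H F))"
    if "S \<in> F \<rightarrow> F" and
      "\<forall>f\<in>F. \<forall>k<K. \<parallel>(S ^^ k) f \<ominus> (T ^^ k) f\<parallel> \<le> \<delta> / (R + 1) * \<parallel>f\<parallel>" for K S
  proof -
    have "real K * (h - \<epsilon>) \<le> real K * h_apr_delta H T \<omega> \<delta>"
      using lt by (intro mult_left_mono) auto
    also have "\<dots> \<le> real (dim_of H F)"
      using that \<omega> small by (intro approx[OF \<omega> \<open>\<delta> > 0\<close> that(1)]) (meson le_less_trans subsetD)
    finally show ?thesis using h by simp
  qed
  moreover have "\<delta> / (R + 1) > 0" using \<open>\<delta> > 0\<close> R(1) by simp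
  ultimately show ?thesis by blast
qed

end

section \<open>The Koopman operator as a linear isometry\<close>

lemma
  fixes f :: "'a \<Rightarrow> 'k :: {real_normed_field, euclidean_space}"
  assumes \<phi>: "measure_preserving M \<phi>" and f: "f \<in> square_integrable M"
  shows square_integrable_comp: "f \<circ> \<phi> \<in> square_integrable M"
    and vnorm_koopman_ae_class:
      "\<parallel>koopman M \<phi> (ae_class M f)\<parallel>\<^bsub>L2 M\<^esub> = \<parallel>ae_class M f\<parallel>\<^bsub>L2 M\<^esub>"
proof -
  have [measurable]: "f \<in> borel_measurable M" "\<phi> \<in> measurable M M"
    using f \<phi> by (auto simp: square_integrable_def measure_preserving_def)
  \<comment> \<open>Invariance of the measure means \<open>distr M M \<phi> = M\<close>, so
    integrability and the integral transfer to the composition by change of variables.\<close>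
  have "integrable (distr M M \<phi>) (\<lambda>x. (norm (f x))\<^sup>2)"
    using f by (simp add: measure_preserving_distr[OF \<phi>] square_integrable_def)
  then show "f \<circ> \<phi> \<in> square_integrable M"
    by (simp add: square_integrable_def integrable_distr_eq comp_def)
  have "(\<integral>x. (norm (f x))\<^sup>2 \<partial>distr M M \<phi>) = (\<integral>x. (norm (f (\<phi> x)))\<^sup>2 \<partial>M)"
    by (simp add: integral_distr)
  then show "\<parallel>koopman M \<phi> (ae_class M f)\<parallel>\<^bsub>L2 M\<^esub> = \<parallel>ae_class M f\<parallel>\<^bsub>L2 M\<^esub>"
    by (simp add: koopman_ae_class[OF \<phi>] L2_vnorm measure_preserving_distr[OF \<phi>] comp_def)
qed

text \<open>Each vector is the class of a square-integrable function, and on such classes the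
  operations of \<open>L2 M\<close> and \<open>koopman\<close> act pointwise. Linearity thus becomes
  a pointwise identity.\<close>

lemma koopman_linear_isometry:
  assumes \<phi>: "measure_preserving M \<phi>"
  shows "linear_isometry
    (L2 M :: ('k :: {real_normed_field, euclidean_space}, ('a \<Rightarrow> 'k) set) normed_module) (koopman M \<phi>)"
    (is "linear_isometry ?H ?T")
proof -
  interpret vectorspace "class_ring :: 'k ring" ?H by (rule vectorspace_L2)
  have [measurable]: "\<phi> \<in> measurable M M"
    using \<phi> by (simp add: measure_preserving_def)
  have cl: "ae_class M f \<in> carrier ?H" if "f \<in> square_integrable M" for f :: "'a \<Rightarrow> 'k"
    using that by (simp add: L2_def)
  show ?thesis
  proof
    fix v c assume "v \<in> carrier ?H"
    then obtain f where f: "f \<in> square_integrable M" "v = ae_class M f" by (rule L2_carrierE)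
    then have [measurable]: "f \<in> borel_measurable M" by (simp add: square_integrable_measurable)
    show "\<parallel>c \<odot>\<^bsub>?H\<^esub> v\<parallel>\<^bsub>?H\<^esub> = norm c * \<parallel>v\<parallel>\<^bsub>?H\<^esub>"
      by (simp add: f(2) L2_smult L2_vnorm norm_mult power_mult_distrib real_sqrt_mult)
    show "\<parallel>?T v\<parallel>\<^bsub>?H\<^esub> = \<parallel>v\<parallel>\<^bsub>?H\<^esub>"
      using vnorm_koopman_ae_class[OF \<phi> f(1)] f(2) by simp
  next
    have "?T v \<in> carrier ?H" if "v \<in> carrier ?H" for v
      using that by (auto elim!: L2_carrierE intro!: cl square_integrable_comp[OF \<phi>]
          simp: koopman_ae_class[OF \<phi>] square_integrable_measurable)
    moreover have "?T (v \<oplus>\<^bsub>?H\<^esub> w) = ?T v \<oplus>\<^bsub>?H\<^esub> ?T w"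
      if "v \<in> carrier ?H" "w \<in> carrier ?H" for v w
    proof -
      obtain f g where fg: "f \<in> square_integrable M" "v = ae_class M f"
        "g \<in> square_integrable M" "w = ae_class M g"
        using \<open>v \<in> carrier ?H\<close> \<open>w \<in> carrier ?H\<close> by (metis L2_carrierE)
      then have [measurable]: "f \<in> borel_measurable M" "g \<in> borel_measurable M"
        by (simp_all add: square_integrable_measurable)
      show ?thesis by (simp add: fg L2_add koopman_ae_class[OF \<phi>] comp_def)
    qed
    moreover have "?T (c \<odot>\<^bsub>?H\<^esub> v) = c \<odot>\<^bsub>?H\<^esub> ?T v" if "v \<in> carrier ?H" for c v
    proof -
      obtain f where f: "f \<in> square_integrable M" "v = ae_class M f"
        using \<open>v \<in> carrier ?H\<close> by (rule L2_carrierE)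
      then have [measurable]: "f \<in> borel_measurable M"
        by (simp add: square_integrable_measurable)
      show ?thesis by (simp add: f L2_smult koopman_ae_class[OF \<phi>] comp_def)
    qed
    ultimately show "?T \<in> module_hom class_ring ?H ?H"
      by (auto simp: module_hom_def)
  qed
qed

theorem theorem1p2:
  fixes M :: "'a measure"
    and \<phi> :: "'a \<Rightarrow> 'a"
    and F :: "('a \<Rightarrow> 'k :: {real_normed_field, euclidean_space}) set set"
    and \<epsilon> :: real
  assumes "invertible_mps M \<phi>"
    and "fin_dim_subspace (L2 M) F"
    and "\<epsilon> > 0"
  shows "\<exists>(K\<^sub>0 :: nat) (\<delta> :: real). \<delta> > 0 \<and>
    (\<forall>K\<ge>K\<^sub>0. \<forall>S \<in> module_hom class_ring ((L2 M)\<lparr>carrier := F\<rparr>) ((L2 M)\<lparr>carrier := F\<rparr>).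
       (\<forall>f\<in>F. \<forall>k\<in>{0..<K}.
          \<parallel>(S ^^ k) f \<ominus>\<^bsub>L2 M\<^esub> (koopman M \<phi> ^^ k) f\<parallel>\<^bsub>L2 M\<^esub> \<le> \<delta> * \<parallel>f\<parallel>\<^bsub>L2 M\<^esub>) \<longrightarrow>
       ereal (real (dim_of (L2 M) F)) \<ge>
         ereal (real K) * (h_apr (L2 M) (koopman M \<phi>) F - ereal \<epsilon>))"
proof -
  have "measure_preserving M \<phi>" using assms(1) by (simp add: invertible_mps_def)
  then interpret linear_isometry
      "L2 M :: ('k, ('a \<Rightarrow> 'k) set) normed_module" "koopman M \<phi>"
    by (rule koopman_linear_isometry)
  obtain \<delta> where \<delta>: "\<delta> > 0"
    and *: "\<And>K S. S \<in> F \<rightarrow> F \<Longrightarrow>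
      \<forall>f\<in>F. \<forall>k<K. \<parallel>(S ^^ k) f \<ominus>\<^bsub>L2 M\<^esub> (koopman M \<phi> ^^ k) f\<parallel>\<^bsub>L2 M\<^esub> \<le> \<delta> * \<parallel>f\<parallel>\<^bsub>L2 M\<^esub> \<Longrightarrow>
      ereal (real K) * (h_apr (L2 M) (koopman M \<phi>) F - ereal \<epsilon>) \<le> ereal (real (dim_of (L2 M) F))"
    using dim_ge_of_approximate_operator[OF assms(2,3)] by metis
  show ?thesis
  \<comment> \<open>The threshold 0 works because the chosen \<open>\<delta>\<close> serves every
    \<open>K\<close> at once.\<close>
  proof (intro exI[of _ "0 :: nat"] exI[of _ \<delta>] conjI \<delta> allI ballI impI)
    fix K S
    assume S: "S \<in> module_hom class_ring ((L2 M)\<lparr>carrier := F\<rparr>) ((L2 M)\<lparr>carrier := F\<rparr>)"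
      and le: "\<forall>f\<in>F. \<forall>k\<in>{0..<K}.
          \<parallel>(S ^^ k) f \<ominus>\<^bsub>L2 M\<^esub> (koopman M \<phi> ^^ k) f\<parallel>\<^bsub>L2 M\<^esub> \<le> \<delta> * \<parallel>f\<parallel>\<^bsub>L2 M\<^esub>"
    have "S \<in> F \<rightarrow> F"
      using module_hom_closed[OF S] by simp
    then show "ereal (real K) * (h_apr (L2 M) (koopman M \<phi>) F - ereal \<epsilon>)
        \<le> ereal (real (dim_of (L2 M) F))"
      using le by (intro *) auto
  qed
qed

end
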